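(* Let $n\in\mathbb{N}$ and $u,v\in\mathcal{A}_n^*$. Then $u\equiv_{\mathrm{hypo}} v$ if and only if $u\sim v$, i.e. if and only if there is a quasi-crystal isomorphism $\theta:\Gamma_n(u)\to\Gamma_n(v)$ with $\theta(u)=v$.
   Context: Let $\mathcal{A}_n=\{1<2<\dots<n\}$ and $\mathcal{A}_n^*$ the free monoid of words over it. The weight of a word $u$ is $\mathrm{wt}(u)=(|u|_1,\dots,|u|_n)$, where $|u|_a$ is the number of occurrences of $a$ in $u$. Quasi-Kashiwara operators: for $i\in\{1,\dots,n-1\}$, a word $u$ has an $i$-inversion if it contains a letter $i+1$ somewhere to the left of a letter $i$. If $u$ has an $i$-inversion, $e_i(u)$ and $f_i(u)$ are undefined. Otherwise, $e_i(u)$ is obtained by replacing the leftmost letter $i+1$ of $u$ by $i$ (undefined if $u$ has no letter $i+1$), and $f_i(u)$ is obtained by replacing the rightmost letter $i$ of $u$ by $i+1$ (undefined if $u$ has no letter $i$). The quasi-crystal graph $\Gamma_n$ is the directed graph with vertex set $\mathcal{A}_n^*$ and an edge $u\to f_i(u)$ labelled $i$ whenever $f_i(u)$ is defined. $\Gamma_n(u)$ denotes the connected component containing $u$. A quasi-crystal isomorphism between two components is a bijection preserving weight and such that there is an edge $x\to y$ labelled $i$ iff there is an edge between the images labelled $i$. Write $u\sim v$ if there is a quasi-crystal isomorphism $\theta:\Gamma_n(u)\to\Gamma_n(v)$ with $\theta(u)=v$. Quasi-ribbon tableaux: a composition $\alpha=(\alpha_1,\dots,\alpha_k)$ (positive parts)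 determines a ribbon diagram with $\alpha_h$ boxes in row $h$ (rows top to bottom), where the leftmost box of each row is directly below the rightmost box of the previous row. A quasi-ribbon tableau is such a diagram filled with positive integers so that rows weakly increase left to right and columns strictly increase top to bottom; its cells, listed along the ribbon from top-left to bottom-right, carry weakly increasing entries. Insertion of a letter $a$ into a quasi-ribbon tableau $T$ (Krob–Thibon): if no entry of $T$ is $\le a$ (including $T$ empty), create a cell $a$ and attach $T$ so that its first cell is directly below $a$; if no entry of $T$ is $>a$, attach a new cell $a$ directly to the right of the last cell of $T$; otherwise let $x$ be the last cell (along the ribbon) with entry $\le a$ and $z$ the next cell, and form the tableau consisting of the part of $T$ up to $x$, a new cell $a$ directly to the right of $x$, and the remainder of $T$ from $z$ onwards attached so that $z$ is directly below the new cell $a$. For a word $w=a_1\cdots a_k$, $\mathrm{QR}(w)$ is obtained by inserting $a_1,\dots,a_k$ successively starting from the empty tableau. The hypoplactic congruence is $u\equiv_{\mathrm{hypo}} v$ iff $\mathrm{QR}(u)=\mathrm{QR}(v)$. *)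

theory Defs
  imports Main
begin

definition words :: "nat \<Rightarrow> nat list set" where
  "words n = lists {1..n}"

definition wt :: "nat \<Rightarrow> nat list \<Rightarrow> nat list" where
  "wt n u = map (count_list u) [1..<Suc n]"

definition has_inversion :: "nat \<Rightarrow> nat list \<Rightarrow> bool" where
  "has_inversion i u \<longleftrightarrow> (\<exists>p q. p < q \<and> q < length u \<and> u ! p = i + 1 \<and> u ! q = i)"

definition kashiwara_f :: "nat \<Rightarrow> nat list \<Rightarrow> nat list option" where
  "kashiwara_f i u =
     (if has_inversion i u \<or> i \<notin> set u then None
      else Some (u[Max {p. p < length u \<and> u ! p = i} := i + 1]))"

definition edge :: "nat \<Rightarrow> nat \<Rightarrow> nat list \<Rightarrow> nat list \<Rightarrow> bool" where
  "edge n i x y \<longleftrightarrow> x \<in> words n \<and> 1 \<le> i \<and> i < n \<and> kashiwara_f i x = Some y"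

text \<open>Connectedness ignores the direction of the edges.\<close>

definition component :: "nat \<Rightarrow> nat list \<Rightarrow> nat list set" where
  "component n u = {x. equivclp (\<lambda>y z. \<exists>i. edge n i y z) u x}"

definition quasi_crystal_iso ::
  "nat \<Rightarrow> (nat list \<Rightarrow> nat list) \<Rightarrow> nat list set \<Rightarrow> nat list set \<Rightarrow> bool" where
  "quasi_crystal_iso n \<theta> X Y \<longleftrightarrow>
     bij_betw \<theta> X Y \<and>
     (\<forall>x\<in>X. wt n (\<theta> x) = wt n x) \<and>
     (\<forall>x\<in>X. \<forall>y\<in>X. \<forall>i\<in>{1..<n}. edge n i x y \<longleftrightarrow> edge n i (\<theta> x) (\<theta> y))"

definition crystal_equiv :: "nat \<Rightarrow> nat list \<Rightarrow> nat list \<Rightarrow> bool" where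
  "crystal_equiv n u v \<longleftrightarrow>
     (\<exists>\<theta>. quasi_crystal_iso n \<theta> (component n u) (component n v) \<and> \<theta> u = v)"

text \<open>
  A filled ribbon diagram is the list of its rows, top to bottom; its shape is the composition
  given by the row lengths, so the rows have to be nonempty.  In a ribbon, the only vertically
  adjacent cells are the last cell of a row and the first cell of the next row.
\<close>

definition quasi_ribbon_tableau :: "nat list list \<Rightarrow> bool" where
  "quasi_ribbon_tableau T \<longleftrightarrow>
     (\<forall>r\<in>set T. r \<noteq> [] \<and> sorted r \<and> (\<forall>x\<in>set r. 1 \<le> x)) \<and>
     successively (\<lambda>r s. last r < hd s) T"

text \<open>
  In the last case, \<open>T ! h ! j\<close> is the last cell along the ribbon with entry at most \<open>a\<close>.  If it
  ends its row, the next cell already starts row \<open>h + 1\<close>; otherwise row \<open>h\<close> is split after it.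
\<close>

definition qr_insert :: "nat \<Rightarrow> nat list list \<Rightarrow> nat list list" where
  "qr_insert a T =
     (if \<forall>x\<in>set (concat T). \<not> x \<le> a then [a] # T
      else if \<forall>x\<in>set (concat T). \<not> x > a then butlast T @ [last T @ [a]]
      else
        let h = Max {h. h < length T \<and> (\<exists>x\<in>set (T ! h). x \<le> a)};
            j = Max {j. j < length (T ! h) \<and> T ! h ! j \<le> a};
            rest = drop (Suc j) (T ! h)
        in take h T @ [take (Suc j) (T ! h) @ [a]]
             @ (if rest = [] then [] else [rest]) @ drop (Suc h) T)"

definition QR :: "nat list \<Rightarrow> nat list list" where
  "QR w = fold qr_insert w []"

lemma quasi_ribbon_tableau_insert:
  assumes T: "quasi_ribbon_tableau T" and a: "1 \<le> a"
  shows "quasi_ribbon_tableau (qr_insert a T)"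
proof -
  have rows: "\<And>r. r \<in> set T \<Longrightarrow> r \<noteq> [] \<and> sorted r \<and> (\<forall>x\<in>set r. 1 \<le> x)"
    and succ: "successively (\<lambda>r s. last r < hd s) T"
    using T by (auto simp: quasi_ribbon_tableau_def)
  consider (top) "\<forall>x\<in>set (concat T). \<not> x \<le> a"
    | (right) "\<not> (\<forall>x\<in>set (concat T). \<not> x \<le> a)" "\<forall>x\<in>set (concat T). \<not> x > a"
    | (mid) "\<not> (\<forall>x\<in>set (concat T). \<not> x \<le> a)" "\<not> (\<forall>x\<in>set (concat T). \<not> x > a)"
    by blast
  then show ?thesis
  proof cases
    case top
    have "a < hd (hd T)" if "T \<noteq> []"
      using that top rows[of "hd T"] by (metis UN_I hd_in_set not_le set_concat)
    then show ?thesis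
      using top T a by (cases T) (auto simp: quasi_ribbon_tableau_def qr_insert_def)
  next
    case right
    then have "T \<noteq> []" by auto
    then obtain S r where S: "T = S @ [r]" by (metis rev_exhaust)
    have "qr_insert a T = S @ [r @ [a]]"
      using right unfolding qr_insert_def S by auto
    moreover have "r \<noteq> []" using rows[of r] S by simp
    moreover have "\<forall>x\<in>set r. x \<le> a" using right(2) S by (simp add: not_less)
    ultimately show ?thesis
      using rows succ a unfolding S
      by (auto simp: quasi_ribbon_tableau_def successively_append_iff sorted_append)
  next
    case mid
    define H where "H = {h. h < length T \<and> (\<exists>x\<in>set (T ! h). x \<le> a)}"
    define h where "h = Max H"
    define r where "r = T ! h"
    define J where "J = {j. j < length r \<and> r ! j \<le> a}"
    define j where "j = Max J"
    have finH: "finite H" and finJ: "finite J" by (auto simp: H_def J_def)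
    from mid(1) obtain s x where "s \<in> set T" "x \<in> set s" "x \<le> a" by auto
    then have "H \<noteq> {}" by (auto simp: H_def in_set_conv_nth[of s T])
    then have hH: "h \<in> H" using finH Max_in h_def by blast
    then have "J \<noteq> {}" by (auto simp: H_def J_def r_def in_set_conv_nth)
    then have jJ: "j \<in> J" using finJ Max_in j_def by blast
    have hl: "h < length T" and jl: "j < length r" and ja: "r ! j \<le> a"
      using hH jJ by (auto simp: H_def J_def)
    have later: "a < x" if "k > h" "k < length T" "x \<in> set (T ! k)" for k x
      using that Max_ge[OF finH, of k] unfolding h_def[symmetric] by (force simp: H_def)
    have after: "a < r ! k" if "k > j" "k < length r" for k
      using that Max_ge[OF finJ, of k] unfolding j_def[symmetric] by (force simp: J_def)
    define A B C D where defs: "A = take h T" "B = take (Suc j) r" "C = drop (Suc j) r"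
      "D = drop (Suc h) T"
    have TE: "T = A @ (B @ C) # D"
      unfolding defs using hl by (simp add: r_def id_take_nth_drop[symmetric])
    have ins: "qr_insert a T = A @ [B @ [a]] @ (if C = [] then [] else [C]) @ D"
      unfolding qr_insert_def defs using mid
      by (simp only: if_False Let_def H_def[symmetric] h_def[symmetric] r_def[symmetric]
            J_def[symmetric] j_def[symmetric])
    have B0: "B \<noteq> []" using jl by (auto simp: defs)
    have srt: "sorted (B @ C)" using rows TE by simp
    have Ba: "\<forall>x\<in>set B. x \<le> a"
    proof
      fix x assume "x \<in> set B"
      then obtain k where "k \<le> j" "x = r ! k"
        by (auto simp: defs in_set_conv_nth less_Suc_eq_le)
      moreover have "sorted r" using srt by (simp add: defs)
      ultimately show "x \<le> a" using ja jl by (meson le_trans sorted_nth_mono)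
    qed
    have C0: "a < hd C" if "C \<noteq> []"
      using that after by (simp add: defs hd_drop_conv_nth)
    have D0: "a < hd (hd D)" if "D \<noteq> []"
    proof -
      have l: "Suc h < length T" using that by (simp add: defs)
      then have "hd D = T ! Suc h" by (simp add: defs hd_drop_conv_nth)
      moreover have "T ! Suc h \<noteq> []" using rows l by simp
      ultimately show ?thesis using later[of "Suc h"] l by simp
    qed
    have rowsA: "\<forall>s\<in>set A \<union> set D. s \<noteq> [] \<and> sorted s \<and> (\<forall>x\<in>set s. 1 \<le> x)"
      using rows TE by auto
    have pos: "\<forall>x\<in>set B \<union> set C. 1 \<le> x"
      using rows[of "B @ C"] TE by auto
    have sA: "successively (\<lambda>r s. last r < hd s) A"
      and sD: "successively (\<lambda>r s. last r < hd s) D"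
      and AB: "A \<noteq> [] \<Longrightarrow> last (last A) < hd B"
      and CD: "D \<noteq> [] \<Longrightarrow> C \<noteq> [] \<Longrightarrow> last C < hd (hd D)"
      using succ B0 unfolding TE by (auto simp: successively_append_iff successively_Cons)
    show ?thesis
      using rowsA pos sA sD AB CD a B0 Ba C0 D0 srt unfolding ins quasi_ribbon_tableau_def
      by (auto simp: successively_append_iff sorted_append successively_Cons)
  qed
qed

lemma quasi_ribbon_tableau_QR:
  assumes "w \<in> words n"
  shows "quasi_ribbon_tableau (QR w)"
proof -
  have "quasi_ribbon_tableau (fold qr_insert w T)"
    if "quasi_ribbon_tableau T" "\<forall>x\<in>set w. 1 \<le> x" for T
    using that by (induction w arbitrary: T) (auto simp: quasi_ribbon_tableau_insert)
  moreover have "quasi_ribbon_tableau []" by (simp add: quasi_ribbon_tableau_def)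
  ultimately show ?thesis using assms by (auto simp: QR_def words_def)
qed

definition hypo_cong :: "nat list \<Rightarrow> nat list \<Rightarrow> bool" where
  "hypo_cong u v \<longleftrightarrow> QR u = QR v"

end

theory Submission
  imports Defs "HOL-Library.Multiset"
begin

text \<open>
  \<open>QR w\<close> is the sorted word of \<open>w\<close>, cut between neighbouring letters \<open>a < b\<close> of the support exactly
  when some \<open>b\<close> precedes some \<open>a\<close> in \<open>w\<close>.  Hence hypoplactic congruence means equal content and
  equal inversions between neighbouring letters, a relation that every quasi-Kashiwara operator and
  its inverse preserves.  Applying the same operators to \<open>u\<close> and \<open>v\<close> in parallel therefore links
  the two components; since the operators also preserve standardizations, and a word is determined
  by its content and its standardization, this link is a bijection.  Conversely, the inversions
  between neighbouring letters can be read off from which operators are defined along a path.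
\<close>

section \<open>Inversions between two arbitrary letters\<close>

text \<open>Both letters are parameters because neighbouring letters of a support need not differ by
  one. The recursion makes the effect of concatenation easy to compute.\<close>

primrec inverted :: "'a \<Rightarrow> 'a \<Rightarrow> 'a list \<Rightarrow> bool" where
  "inverted a b [] \<longleftrightarrow> False"
| "inverted a b (c # w) \<longleftrightarrow> c = b \<and> a \<in> set w \<or> inverted a b w"

lemma inverted_append:
  "inverted a b (v @ w) \<longleftrightarrow> inverted a b v \<or> inverted a b w \<or> b \<in> set v \<and> a \<in> set w"
  by (induction v) auto

lemma inverted_imp_mem: "inverted a b w \<Longrightarrow> a \<in> set w \<and> b \<in> set w"
  by (induction w) auto

lemma has_inversion_iff: "has_inversion i w \<longleftrightarrow> inverted i (Suc i) w"
proof (induction w)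
  case Nil
  then show ?case by (simp add: has_inversion_def)
next
  case (Cons c w)
  have "has_inversion i (c # w) \<longleftrightarrow> c = Suc i \<and> i \<in> set w \<or> has_inversion i w"
    (is "?L \<longleftrightarrow> ?R")
  proof
    assume ?L
    then obtain p q where pq: "p < q" "q < Suc (length w)"
        "(c # w) ! p = Suc i" "(c # w) ! q = i"
      by (auto simp: has_inversion_def)
    then obtain q' where q': "q = Suc q'" by (cases q) auto
    show ?R
      using pq unfolding q' has_inversion_def by (cases p) auto
  next
    assume ?R
    then show ?L
    proof
      assume "c = Suc i \<and> i \<in> set w"
      then obtain q where "c = Suc i" "q < length w" "w ! q = i"
        by (auto simp: in_set_conv_nth)
      then show ?L
        unfolding has_inversion_def by (intro exI[of _ 0] exI[of _ "Suc q"]) auto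
    next
      assume "has_inversion i w"
      then obtain p q where "p < q" "q < length w" "w ! p = Suc i" "w ! q = i"
        by (auto simp: has_inversion_def)
      then show ?L
        unfolding has_inversion_def by (intro exI[of _ "Suc p"] exI[of _ "Suc q"]) auto
    qed
  qed
  then show ?case using Cons by simp
qed

section \<open>Quasi-ribbon tableaux as sorted words cut at inversions\<close>

fun cut :: "('a \<Rightarrow> 'a \<Rightarrow> bool) \<Rightarrow> 'a list \<Rightarrow> 'a list list" where
  "cut R [] = []"
| "cut R [x] = [[x]]"
| "cut R (x # y # zs) =
     (if R x y then [x] # cut R (y # zs)
      else (x # hd (cut R (y # zs))) # tl (cut R (y # zs)))"

lemma cut_eq_Nil_iff [simp]: "cut R xs = [] \<longleftrightarrow> xs = []"
  by (induction R xs rule: cut.induct) auto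

lemma Nil_notin_cut: "[] \<notin> set (cut R xs)"
proof (induction R xs rule: cut.induct)
  case (3 R x y zs)
  then show ?case by (cases "cut R (y # zs)") (auto split: if_splits)
qed auto

lemma concat_cut [simp]: "concat (cut R xs) = xs"
proof (induction R xs rule: cut.induct)
  case (3 R x y zs)
  then show ?case by (cases "cut R (y # zs)") (auto split: if_splits)
qed auto

lemma hd_cut_neq_Nil: "xs \<noteq> [] \<Longrightarrow> hd (cut R xs) \<noteq> []"
  using Nil_notin_cut[of R xs] by (metis cut_eq_Nil_iff list.set_sel(1))

text \<open>As rows are never empty, the first row is a singleton exactly when a break follows the
  first of at least two letters; so the rows reveal each decision in turn.\<close>

lemma cut_eq_iff:
  "cut R xs = cut R' xs \<longleftrightarrow>
     (\<forall>k. Suc k < length xs \<longrightarrow> R (xs ! k) (xs ! Suc k) = R' (xs ! k) (xs ! Suc k))"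
proof (induction R xs rule: cut.induct)
  case (3 R x y zs)
  let ?c = "cut R (y # zs)" and ?c' = "cut R' (y # zs)"
  have ne: "?c \<noteq> []" "?c' \<noteq> []" "hd ?c \<noteq> []" "hd ?c' \<noteq> []"
    by (simp_all add: hd_cut_neq_Nil)
  have step: "cut R (x # y # zs) = cut R' (x # y # zs) \<longleftrightarrow> R x y = R' x y \<and> ?c = ?c'"
  proof (cases "R x y = R' x y")
    case True
    then show ?thesis using ne by (cases ?c; cases ?c') auto
  next
    case False
    then have "hd (cut R (x # y # zs)) \<noteq> hd (cut R' (x # y # zs))" using ne by simp
    then show ?thesis using False by metis
  qed
  have "?c = ?c' \<longleftrightarrow> (\<forall>k. Suc k < length (y # zs) \<longrightarrow>
      R ((y # zs) ! k) ((y # zs) ! Suc k) = R' ((y # zs) ! k) ((y # zs) ! Suc k))"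
    using 3 by (cases "R x y") blast+
  then show ?case unfolding step by (simp add: All_less_Suc2)
qed auto

text \<open>Breaks depend on adjacent letters only, so the junction is the single new
  decision.\<close>

lemma cut_append:
  assumes "xs \<noteq> []" "ys \<noteq> []"
  shows "cut R (xs @ ys) =
    (if R (last xs) (hd ys) then cut R xs @ cut R ys
     else butlast (cut R xs) @ (last (cut R xs) @ hd (cut R ys)) # tl (cut R ys))"
  using assms(1)
proof (induction R xs rule: cut.induct)
  case (2 R x)
  then show ?case using assms(2) by (cases ys) auto
next
  case (3 R x y zs)
  have "cut R (y # zs) \<noteq> []" by simp
  then obtain r rs where r: "cut R (y # zs) = r # rs" by (cases "cut R (y # zs)") auto
  then show ?case using 3 by (auto simp: Let_def)
qed simp

text \<open>
  A single form covering every insertion into a tableau with an entry at most \<open>a\<close>: row \<open>B @ C\<close>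
  holds the last such entry, at the end of \<open>B\<close>.
\<close>

lemma qr_insert_split:
  assumes le: "\<forall>x\<in>set (concat A) \<union> set B. x \<le> a"
    and gt: "\<forall>x\<in>set C \<union> set (concat D). a < x"
    and B: "B \<noteq> []" and CD: "C = [] \<Longrightarrow> [] \<notin> set D"
  shows "qr_insert a (A @ (B @ C) # D) =
    A @ (B @ [a]) # (if C = [] then [] else [C]) @ D"
proof -
  let ?T = "A @ (B @ C) # D"
  have 1: "\<not> (\<forall>x\<in>set (concat ?T). \<not> x \<le> a)"
    using le B by (cases B) auto
  show ?thesis
  proof (cases "\<forall>x\<in>set (concat ?T). \<not> x > a")
    case True
    then have "C = []" "concat D = []"
      using gt by (metis UnCI concat_append concat.simps(2) last_in_set set_append)+
    \<comment> \<open>\<open>concat D = []\<close> alone would still allow empty rows in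
      \<open>D\<close>; \<open>CD\<close> excludes them.\<close>
    moreover from this have "D = []" using CD by (cases D) auto
    ultimately show ?thesis
      using 1 True unfolding qr_insert_def by simp
  next
    case False
    have H: "{h. h < length ?T \<and> (\<exists>x\<in>set (?T ! h). x \<le> a)} \<subseteq> {..length A}"
    proof
      fix h assume h: "h \<in> {h. h < length ?T \<and> (\<exists>x\<in>set (?T ! h). x \<le> a)}"
      show "h \<in> {..length A}"
      proof (rule ccontr)
        assume "h \<notin> {..length A}"
        then obtain k where k: "h = Suc (length A + k)"
          using less_iff_Suc_add by (auto simp: not_le)
        then have "?T ! h = D ! k" "k < length D" using h by (auto simp: nth_append)
        then have "?T ! h \<in> set D" by simp
        moreover obtain x where "x \<in> set (?T ! h)" "x \<le> a" using h by blast
        ultimately show False using gt by (auto dest: leD)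
      qed
    qed
    have M1: "Max {h. h < length ?T \<and> (\<exists>x\<in>set (?T ! h). x \<le> a)} = length A"
    proof (rule Max_eqI)
      show "length A \<in> {h. h < length ?T \<and> (\<exists>x\<in>set (?T ! h). x \<le> a)}"
        using le B by (auto intro!: bexI[of _ "hd B"])
      show "finite {h. h < length ?T \<and> (\<exists>x\<in>set (?T ! h). x \<le> a)}"
        using H by (rule finite_subset) simp
      show "h \<le> length A" if "h \<in> {h. h < length ?T \<and> (\<exists>x\<in>set (?T ! h). x \<le> a)}" for h
        using subsetD[OF H that] by simp
    qed
    \<comment> \<open>The last cell of \<open>B\<close>: entries of \<open>C\<close> exceed
      \<open>a\<close>, and \<open>B\<close> is nonempty, so the subtraction does not
      truncate.\<close>
    have M2: "Max {j. j < length (B @ C) \<and> (B @ C) ! j \<le> a} = length B - 1"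
    proof (rule Max_eqI)
      show "j \<le> length B - 1" if "j \<in> {j. j < length (B @ C) \<and> (B @ C) ! j \<le> a}" for j
      proof (rule ccontr)
        assume "\<not> j \<le> length B - 1"
        then have "(B @ C) ! j \<in> set C" using that by (auto simp: nth_append)
        then show False using that gt by (auto dest: leD)
      qed
      show "length B - 1 \<in> {j. j < length (B @ C) \<and> (B @ C) ! j \<le> a}"
        using B le by (cases B rule: rev_cases) (auto simp: nth_append)
    qed auto
    have "?T ! length A = B @ C" by simp
    then have "qr_insert a ?T = take (length A) ?T @ [take (Suc (length B - 1)) (B @ C) @ [a]]
        @ (if drop (Suc (length B - 1)) (B @ C) = [] then [] else [drop (Suc (length B - 1)) (B @ C)])
        @ drop (Suc (length A)) ?T"
      using 1 False by (simp only: qr_insert_def if_False Let_def M1 M2)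
    then show ?thesis using B by simp
  qed
qed

text \<open>The conjunct \<open>x < y\<close> keeps equal letters in one row:
  \<open>inverted x x w\<close> holds as soon as \<open>x\<close> occurs twice.\<close>

definition hypo_cut :: "nat list \<Rightarrow> nat \<Rightarrow> nat \<Rightarrow> bool" where
  "hypo_cut w x y \<longleftrightarrow> x < y \<and> inverted x y w"

text \<open>Induction on the last letter \<open>a\<close>, which enters the sorted word between the
  letters at most \<open>a\<close> and those above. It is inverted with every larger letter, so a
  break follows it; breaks inside the two parts stay as they are.\<close>

lemma QR_conv_cut: "QR w = cut (hypo_cut w) (sort w)"
proof (induction w rule: rev_induct)
  case Nil
  then show ?case by (simp add: QR_def)
next
  case (snoc a w)
  define lo where "lo = filter (\<lambda>x. x \<le> a) (sort w)"
  define hi where "hi = filter (\<lambda>x. \<not> x \<le> a) (sort w)"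
  let ?R = "hypo_cut w" and ?R' = "hypo_cut (w @ [a])"
  have m: "mset lo + mset hi = mset w"
    unfolding lo_def hi_def by (simp add: mset_filter multiset_partition[symmetric])
  have srt: "sorted lo" and srt_hi: "sorted hi"
    unfolding lo_def hi_def by (simp_all add: sorted_wrt_filter)
  have le: "\<forall>x\<in>set lo. x \<le> a" and gt: "\<forall>x\<in>set hi. a < x"
    by (auto simp: lo_def hi_def)
  have split: "sort w = lo @ hi"
    using m srt srt_hi le gt by (intro properties_for_sort) (fastforce simp: sorted_append)+
  have split': "sort (w @ [a]) = lo @ a # hi"
    using m srt srt_hi le gt by (intro properties_for_sort) (fastforce simp: sorted_append)+
  have memw: "set w = set lo \<union> set hi" using split by (metis set_append set_sort)
  \<comment> \<open>A letter appended at the end can only be the smaller one of a new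
    inversion.\<close>
  have R': "?R' x y \<longleftrightarrow> ?R x y \<or> x < y \<and> x = a \<and> y \<in> set w" for x y
    by (auto simp: hypo_cut_def inverted_append)
  have lo': "cut ?R' lo = cut ?R lo"
    unfolding cut_eq_iff R' using le by (metis Suc_lessD leD nth_mem)
  have hi': "cut ?R' hi = cut ?R hi"
    unfolding cut_eq_iff R' using gt by (metis Suc_lessD less_irrefl nth_mem)
  have a_hi: "cut ?R' (a # hi) = [a] # cut ?R hi"
  proof (cases hi)
    case (Cons y ys)
    then have "?R' a y" using gt memw by (auto simp: R')
    then show ?thesis using hi' Cons by simp
  qed simp
  have step: "QR (w @ [a]) = qr_insert a (cut ?R (lo @ hi))"
    using snoc split by (simp add: QR_def)
  show ?case
  proof (cases "lo = []")
    case True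
    then show ?thesis
      using gt a_hi unfolding step split' by (auto simp: qr_insert_def)
  next
    case False
    \<comment> \<open>If \<open>last lo < a\<close>, then \<open>a\<close> does not occur in
      \<open>w\<close>, so no \<open>a\<close> stands to the left of a
      \<open>last lo\<close>.\<close>
    have nR': "\<not> ?R' (last lo) a"
    proof
      assume "?R' (last lo) a"
      then have *: "last lo < a" "a \<in> set w"
        using inverted_imp_mem[of "last lo" a w] by (auto simp: inverted_append hypo_cut_def)
      then have "a \<in> set lo" using memw gt by auto
      then have "a \<in> set (butlast lo @ [last lo])" "sorted (butlast lo @ [last lo])"
        using srt False by simp_all
      then have "a \<le> last lo" by (auto simp: sorted_append)
      then show False using * by simp
    qed
    obtain A B where AB: "cut ?R lo = A @ [B]" using False by (metis cut_eq_Nil_iff rev_exhaust)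
    have B: "B \<noteq> []" using Nil_notin_cut[of ?R lo] AB by auto
    have loAB: "lo = concat A @ B" using concat_cut[of ?R lo] AB by simp
    have target: "cut ?R' (lo @ a # hi) = A @ (B @ [a]) # cut ?R hi"
      using cut_append[of lo "a # hi" ?R'] False nR' lo' a_hi AB by simp
    have ins: "qr_insert a (A @ (B @ C) # D) = A @ (B @ [a]) # (if C = [] then [] else [C]) @ D"
      if "hi = C @ concat D" "C = [] \<Longrightarrow> [] \<notin> set D" for C D
      using that le gt loAB B by (intro qr_insert_split) auto
    show ?thesis
    \<comment> \<open>Either the row of the last entry at most \<open>a\<close> ends there, so
      \<open>C\<close> is empty, or it continues with the first row of \<open>hi\<close>, which the
      insertion splits off.\<close>
    proof (cases "hi = [] \<or> ?R (last lo) (hd hi)")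
      case True
      then have "cut ?R (lo @ hi) = A @ (B @ []) # cut ?R hi"
        using cut_append[of lo hi ?R] AB False by (cases "hi = []") auto
      then show ?thesis
        using ins[of "[]" "cut ?R hi"] target step split' Nil_notin_cut[of ?R hi] by simp
    next
      case False
      then have "cut ?R (lo @ hi) = A @ (B @ hd (cut ?R hi)) # tl (cut ?R hi)"
        using cut_append[of lo hi ?R] AB \<open>lo \<noteq> []\<close> by auto
      moreover have "hd (cut ?R hi) \<noteq> []" "cut ?R hi \<noteq> []" using False hd_cut_neq_Nil by auto
      moreover have "hi = hd (cut ?R hi) @ concat (tl (cut ?R hi))"
        using False by (metis concat.simps(2) concat_cut cut_eq_Nil_iff list.collapse)
      ultimately show ?thesis
        using ins[of "hd (cut ?R hi)" "tl (cut ?R hi)"] target step split' by simp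
    qed
  qed
qed

section \<open>Hypoplactic congruence in terms of inversions\<close>

text \<open>The inner condition says that no letter of \<open>u\<close> lies strictly between
  \<open>a\<close> and \<open>b\<close>. If \<open>a\<close> or \<open>b\<close> does not occur,
  both sides of the equation are false.\<close>

definition same_inversions :: "nat list \<Rightarrow> nat list \<Rightarrow> bool" where
  "same_inversions u v \<longleftrightarrow> mset u = mset v \<and>
     (\<forall>a b. a < b \<longrightarrow> (\<forall>c\<in>set u. c \<le> a \<or> b \<le> c) \<longrightarrow> inverted a b u = inverted a b v)"

lemma sorted_consecutive_nth:
  fixes xs :: "'a :: linorder list"
  assumes "sorted xs" "a \<in> set xs" "b \<in> set xs" "a < b" "\<forall>c\<in>set xs. c \<le> a \<or> b \<le> c"
  shows "\<exists>k. Suc k < length xs \<and> xs ! k = a \<and> xs ! Suc k = b"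
  using assms
proof (induction xs)
  case (Cons x xs)
  show ?case
  proof (cases "a \<in> set xs")
    case True
    moreover have "b \<in> set xs" using Cons.prems True by (auto dest: leD)
    ultimately obtain k where "Suc k < length xs \<and> xs ! k = a \<and> xs ! Suc k = b"
      using Cons by auto
    then show ?thesis by (intro exI[of _ "Suc k"]) auto
  next
    case False
    then have x: "x = a" "b \<in> set xs" using Cons.prems by auto
    then obtain y ys where y: "xs = y # ys" by (cases xs) auto
    have "y = b"
      using Cons.prems False x unfolding y by (auto dest: antisym)
    then show ?thesis using x y by (intro exI[of _ 0]) auto
  qed
qed simp

lemma sorted_nth_consecutive:
  fixes xs :: "'a :: linorder list"
  assumes "sorted xs" "Suc k < length xs" "c \<in> set xs"
  shows "c \<le> xs ! k \<or> xs ! Suc k \<le> c"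
proof -
  obtain l where "l < length xs" "c = xs ! l" using assms(3) by (auto simp: in_set_conv_nth)
  then show ?thesis
    using assms by (cases "l \<le> k") (auto intro!: sorted_nth_mono)
qed

text \<open>Concatenating the rows recovers the sorted word, hence the content. What remains are the
  breaks, and distinct adjacent letters of the sorted word are exactly the neighbours in the
  support.\<close>

lemma hypo_cong_iff: "hypo_cong u v \<longleftrightarrow> same_inversions u v"
proof
  assume "hypo_cong u v"
  then have eq: "cut (hypo_cut u) (sort u) = cut (hypo_cut v) (sort v)"
    by (simp add: hypo_cong_def QR_conv_cut)
  then have s: "sort u = sort v" by (metis concat_cut)
  then have m: "mset u = mset v" by (metis mset_sort)
  have adj: "hypo_cut u (sort u ! k) (sort u ! Suc k) = hypo_cut v (sort u ! k) (sort u ! Suc k)"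
    if "Suc k < length (sort u)" for k
    using eq that unfolding s[symmetric] cut_eq_iff by blast
  have "inverted a b u = inverted a b v" if ab: "a < b" "\<forall>c\<in>set u. c \<le> a \<or> b \<le> c" for a b
  proof (cases "a \<in> set u \<and> b \<in> set u")
    case True
    then obtain k where "Suc k < length (sort u)" "sort u ! k = a" "sort u ! Suc k = b"
      using sorted_consecutive_nth[of "sort u" a b] ab True by auto
    then show ?thesis using adj[of k] ab by (simp add: hypo_cut_def)
  next
    case False
    then show ?thesis using m by (metis inverted_imp_mem mset_eq_setD)
  qed
  then show "same_inversions u v" using m by (simp add: same_inversions_def)
next
  assume *: "same_inversions u v"
  then have s: "sort u = sort v" by (metis same_inversions_def properties_for_sort sorted_sort mset_sort)
  have "cut (hypo_cut u) (sort u) = cut (hypo_cut v) (sort u)"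
    unfolding cut_eq_iff hypo_cut_def
    using * sorted_nth_consecutive[of "sort u"] by (fastforce simp: same_inversions_def)
  then show "hypo_cong u v" by (simp add: hypo_cong_def QR_conv_cut s)
qed


section \<open>The quasi-Kashiwara operators\<close>

lemma kashiwara_f_split:
  assumes "i \<notin> set B" "Suc i \<notin> set A"
  shows "kashiwara_f i (A @ i # B) = Some (A @ Suc i # B)"
proof -
  have "Max {p. p < length (A @ i # B) \<and> (A @ i # B) ! p = i} = length A"
  proof (rule Max_eqI)
    show "p \<le> length A" if "p \<in> {p. p < length (A @ i # B) \<and> (A @ i # B) ! p = i}" for p
    proof (rule ccontr)
      assume "\<not> p \<le> length A"
      then obtain k where "p = Suc (length A + k)"
        using less_iff_Suc_add by (auto simp: not_le)
      then have "(A @ i # B) ! p \<in> set B"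
        using that by (auto simp: nth_append)
      then show False using that assms by simp
    qed
  qed auto
  moreover have "\<not> inverted i (Suc i) (A @ i # B)"
    using assms inverted_imp_mem[of i "Suc i"] by (auto simp: inverted_append)
  ultimately show ?thesis
    by (simp add: kashiwara_f_def has_inversion_iff)
qed

text \<open>Without inversions, no \<open>Suc i\<close> precedes the rightmost \<open>i\<close>. The
  changed letter thus becomes the leftmost \<open>Suc i\<close> of \<open>y\<close>, so the same
  factorization also describes the inverse operator.\<close>

lemma kashiwara_f_iff:
  "kashiwara_f i x = Some y \<longleftrightarrow>
     (\<exists>A B. x = A @ i # B \<and> y = A @ Suc i # B \<and> i \<notin> set B \<and> Suc i \<notin> set A)"
proof
  assume *: "kashiwara_f i x = Some y"
  then have inv: "\<not> inverted i (Suc i) x" and "i \<in> set x"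
    by (auto simp: kashiwara_f_def has_inversion_iff split: if_splits)
  then obtain A B where x: "x = A @ i # B" and B: "i \<notin> set B"
    using split_list_last by metis
  have A: "Suc i \<notin> set A" using inv unfolding x by (auto simp: inverted_append)
  then have "y = A @ Suc i # B" using * kashiwara_f_split[OF B A] x by simp
  then show "\<exists>A B. x = A @ i # B \<and> y = A @ Suc i # B \<and> i \<notin> set B \<and> Suc i \<notin> set A"
    using x A B by blast
qed (auto simp: kashiwara_f_split)

lemma kashiwara_f_defined_iff:
  "(\<exists>y. kashiwara_f i x = Some y) \<longleftrightarrow> i \<in> set x \<and> \<not> inverted i (Suc i) x"
  by (auto simp: kashiwara_f_def has_inversion_iff)

text \<open>This is the domain of the operator \<open>e_i\<close>, which appears here only as the
  inverse of \<open>kashiwara_f\<close>.\<close>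

lemma kashiwara_f_inverse_defined_iff:
  "(\<exists>x. kashiwara_f i x = Some y) \<longleftrightarrow> Suc i \<in> set y \<and> \<not> inverted i (Suc i) y"
proof
  assume "Suc i \<in> set y \<and> \<not> inverted i (Suc i) y"
  moreover from this obtain A B where y: "y = A @ Suc i # B" and "Suc i \<notin> set A"
    using split_list_first by metis
  moreover have "i \<notin> set B" using calculation by (auto simp: inverted_append)
  ultimately show "\<exists>x. kashiwara_f i x = Some y" using kashiwara_f_iff by blast
next
  assume "\<exists>x. kashiwara_f i x = Some y"
  then show "Suc i \<in> set y \<and> \<not> inverted i (Suc i) y"
    using inverted_imp_mem[of i "Suc i"] by (auto simp: kashiwara_f_iff inverted_append)
qed

text \<open>
  The last two rules cover the case that the support changes: the letter \<open>Suc i\<close> after the step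
  then inherits the inversions of the letter \<open>i\<close> before it.
\<close>

lemma kashiwara_f_inverted:
  assumes "kashiwara_f i x = Some y"
  shows "a \<noteq> i \<Longrightarrow> b \<noteq> i \<Longrightarrow> a \<noteq> Suc i \<Longrightarrow> b \<noteq> Suc i \<Longrightarrow> inverted a b y = inverted a b x"
    and "\<not> inverted i (Suc i) x" "\<not> inverted i (Suc i) y"
    and "a < i \<Longrightarrow> i \<in> set y \<Longrightarrow> inverted a i y = inverted a i x"
    and "Suc i < b \<Longrightarrow> Suc i \<in> set x \<Longrightarrow> inverted (Suc i) b y = inverted (Suc i) b x"
    and "a < i \<Longrightarrow> i \<notin> set y \<Longrightarrow> inverted a (Suc i) y = inverted a i x"
    and "Suc i < b \<Longrightarrow> Suc i \<notin> set x \<Longrightarrow> inverted (Suc i) b y = inverted i b x"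
proof -
  obtain A B where xy: "x = A @ i # B" "y = A @ Suc i # B" "i \<notin> set B" "Suc i \<notin> set A"
    using assms kashiwara_f_iff by blast
  note mem = inverted_imp_mem[of _ _ A] inverted_imp_mem[of _ _ B]
  show "a \<noteq> i \<Longrightarrow> b \<noteq> i \<Longrightarrow> a \<noteq> Suc i \<Longrightarrow> b \<noteq> Suc i \<Longrightarrow> inverted a b y = inverted a b x"
    and "\<not> inverted i (Suc i) x" "\<not> inverted i (Suc i) y"
    using xy mem by (auto simp: inverted_append)
  show "a < i \<Longrightarrow> i \<in> set y \<Longrightarrow> inverted a i y = inverted a i x"
    using xy mem by (auto simp: inverted_append)
  show "Suc i < b \<Longrightarrow> Suc i \<in> set x \<Longrightarrow> inverted (Suc i) b y = inverted (Suc i) b x"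
    using xy mem by (auto simp: inverted_append)
  show "a < i \<Longrightarrow> i \<notin> set y \<Longrightarrow> inverted a (Suc i) y = inverted a i x"
    using xy mem by (auto simp: inverted_append)
  show "Suc i < b \<Longrightarrow> Suc i \<notin> set x \<Longrightarrow> inverted (Suc i) b y = inverted i b x"
    using xy mem by (auto simp: inverted_append)
qed

lemma kashiwara_f_mset:
  assumes "kashiwara_f i x = Some y"
  shows "add_mset (Suc i) (mset x) = add_mset i (mset y)"
    and "i \<in> set x" and "Suc i \<in> set y"
    and "set x \<subseteq> insert i (set y)" and "set y \<subseteq> insert (Suc i) (set x)"
  using assms by (auto simp: kashiwara_f_iff)

section \<open>Invariants of the operators\<close>

text \<open>The pair of \<open>i\<close> and \<open>Suc i\<close> is inverted neither before nor
  after a step. Any other pair of neighbours in one word comes from such a pair in the other, with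
  \<open>i\<close> and \<open>Suc i\<close> exchanged if the support changes. The equivalence serves
  edges in both directions.\<close>

lemma same_inversions_step:
  assumes fx: "kashiwara_f i x = Some x'" and fy: "kashiwara_f i y = Some y'"
  shows "same_inversions x y \<longleftrightarrow> same_inversions x' y'"
proof -
  note inv_x = kashiwara_f_inverted[OF fx] and inv_y = kashiwara_f_inverted[OF fy]
  note mx = kashiwara_f_mset[OF fx] and my = kashiwara_f_mset[OF fy]
  have m: "mset x = mset y \<longleftrightarrow> mset x' = mset y'"
    by (metis mx(1) my(1) add_mset_eq_singleton_iff add_mset_add_mset_same_iff)
  show ?thesis
  proof
    assume same: "same_inversions x y"
    then have sets: "set x = set y" "set x' = set y'"
      using m by (auto simp: same_inversions_def dest: mset_eq_setD)
    have "inverted a b x' = inverted a b y'"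
      if ab: "a < b" "\<forall>c\<in>set x'. c \<le> a \<or> b \<le> c" for a b
    proof -
      \<comment> \<open>The step creates a \<open>Suc i\<close>, which therefore cannot lie strictly
        between \<open>a\<close> and \<open>b\<close>.\<close>
      have gap: "Suc i \<le> a \<or> b \<le> Suc i" using ab mx by blast
      have I: "inverted a' b' x = inverted a' b' y"
        if "a' < b'" "\<forall>c\<in>set x. c \<le> a' \<or> b' \<le> c" for a' b'
        using same that by (simp add: same_inversions_def)
      consider (out) "a \<noteq> i" "b \<noteq> i" "a \<noteq> Suc i" "b \<noteq> Suc i" | (mid) "a = i" "b = Suc i"
        | (b) "b = i" | (a) "a = Suc i" | (b') "a < i" "b = Suc i"
        using ab gap by force
      then show ?thesis
      proof cases
        case out
        then have "b < i \<or> Suc i < a" using ab gap by linarith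
        then have "inverted a b x = inverted a b y" using ab mx(4) by (intro I) auto
        then show ?thesis using inv_x(1) inv_y(1) out by simp
      next
        case mid
        then show ?thesis using inv_x(3) inv_y(3) by simp
      next
        case b
        then show ?thesis
        proof (cases "i \<in> set x'")
          case True
          have "inverted a i x = inverted a i y" using ab b mx(4) by (intro I) auto
          then show ?thesis using inv_x(4) inv_y(4) True ab b sets by simp
        next
          case False
          then show ?thesis using b sets inverted_imp_mem by metis
        qed
      next
        case a
        show ?thesis
        proof (cases "Suc i \<in> set x")
          case True
          have "inverted (Suc i) b x = inverted (Suc i) b y" using ab a mx(4) by (intro I) auto
          then show ?thesis using inv_x(5) inv_y(5) True ab a sets by simp
        next
          case False
          have "\<forall>c\<in>set x. c \<le> i \<or> b \<le> c"
          proof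
            fix c assume "c \<in> set x"
            then have "c = i \<or> c \<le> Suc i \<or> b \<le> c" "c \<noteq> Suc i" using ab a mx(4) False by auto
            then show "c \<le> i \<or> b \<le> c" by linarith
          qed
          then have "inverted i b x = inverted i b y" using ab a by (intro I) auto
          then show ?thesis using inv_x(7) inv_y(7) False ab a sets by simp
        qed
      next
        case b'
        \<comment> \<open>Here \<open>i\<close> lies strictly between the neighbours
          \<open>a\<close> and \<open>Suc i\<close>, so the step used up the only
          \<open>i\<close>.\<close>
        then have i: "i \<notin> set x'" using ab by auto
        have "\<forall>c\<in>set x. c \<le> a \<or> i \<le> c" using b' ab mx(4) by force
        then have "inverted a i x = inverted a i y" using b' by (intro I) auto
        then show ?thesis using inv_x(6) inv_y(6) i b' sets by simp
      qed
    qed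
    then show "same_inversions x' y'" using same m by (simp add: same_inversions_def)
  next
    assume same: "same_inversions x' y'"
    then have sets: "set x = set y" "set x' = set y'"
      using m by (auto simp: same_inversions_def dest: mset_eq_setD)
    have "inverted a b x = inverted a b y"
      if ab: "a < b" "\<forall>c\<in>set x. c \<le> a \<or> b \<le> c" for a b
    proof -
      \<comment> \<open>Dually, the letter \<open>i\<close> that the step raises occurs in
        \<open>x\<close>.\<close>
      have gap: "i \<le> a \<or> b \<le> i" using ab mx by blast
      have I: "inverted a' b' x' = inverted a' b' y'"
        if "a' < b'" "\<forall>c\<in>set x'. c \<le> a' \<or> b' \<le> c" for a' b'
        using same that by (simp add: same_inversions_def)
      consider (out) "a \<noteq> i" "b \<noteq> i" "a \<noteq> Suc i" "b \<noteq> Suc i" | (mid) "a = i" "b = Suc i"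
        | (b) "b = i" | (a) "a = Suc i" | (a') "a = i" "Suc i < b"
        using ab gap by force
      then show ?thesis
      proof cases
        case out
        then have "b < i \<or> Suc i < a" using ab gap by linarith
        then have "inverted a b x' = inverted a b y'" using ab mx(5) by (intro I) auto
        then show ?thesis using inv_x(1) inv_y(1) out by simp
      next
        case mid
        then show ?thesis using inv_x(2) inv_y(2) by simp
      next
        case a
        then show ?thesis
        proof (cases "Suc i \<in> set x")
          case True
          have "inverted (Suc i) b x' = inverted (Suc i) b y'" using ab a mx(5) by (intro I) auto
          then show ?thesis using inv_x(5) inv_y(5) True ab a sets by simp
        next
          case False
          then show ?thesis using a sets inverted_imp_mem by metis
        qed
      next
        case b
        show ?thesis
        proof (cases "i \<in> set x'")
          case True
          have "inverted a i x' = inverted a i y'" using ab b mx(5) by (intro I) auto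
          then show ?thesis using inv_x(4) inv_y(4) True ab b sets by simp
        next
          case False
          have "\<forall>c\<in>set x'. c \<le> a \<or> Suc i \<le> c"
          proof
            fix c assume "c \<in> set x'"
            then have "c = Suc i \<or> c \<le> a \<or> i \<le> c" "c \<noteq> i" using ab b mx(5) False by auto
            then show "c \<le> a \<or> Suc i \<le> c" by linarith
          qed
          then have "inverted a (Suc i) x' = inverted a (Suc i) y'" using ab b by (intro I) auto
          then show ?thesis using inv_x(6) inv_y(6) False ab b sets by simp
        qed
      next
        case a'
        \<comment> \<open>\<open>Suc i\<close> lies strictly between the neighbours \<open>i\<close>
          and \<open>b\<close>, so it first appears with the step.\<close>
        then have i: "Suc i \<notin> set x" using ab by auto
        have "\<forall>c\<in>set x'. c \<le> Suc i \<or> b \<le> c" using a' ab mx(5) by force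
        then have "inverted (Suc i) b x' = inverted (Suc i) b y'" using a' by (intro I) auto
        then show ?thesis using inv_x(7) inv_y(7) i a' sets by simp
      qed
    qed
    then show "same_inversions x y" using same m by (simp add: same_inversions_def)
  qed
qed

text \<open>Standardizations are compared through the positions of the non-inversions.\<close>

definition same_standardization :: "nat list \<Rightarrow> nat list \<Rightarrow> bool" where
  "same_standardization u v \<longleftrightarrow> length u = length v \<and>
     (\<forall>q<length u. \<forall>p<q. u ! p \<le> u ! q \<longleftrightarrow> v ! p \<le> v ! q)"

lemma same_standardization_refl: "same_standardization u u"
  by (simp add: same_standardization_def)

lemma same_standardization_sym: "same_standardization u v \<Longrightarrow> same_standardization v u"
  by (simp add: same_standardization_def)

lemma same_standardization_trans:
  "same_standardization u v \<Longrightarrow> same_standardization v w \<Longrightarrow> same_standardization u w"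
  by (simp add: same_standardization_def)

text \<open>Only comparisons of the changed letter with a \<open>Suc i\<close> before it or an
  \<open>i\<close> after it could flip, and neither occurs.\<close>

lemma kashiwara_f_same_standardization:
  assumes "kashiwara_f i x = Some y"
  shows "same_standardization x y"
proof -
  obtain A B where xy: "x = A @ i # B" "y = A @ Suc i # B" "i \<notin> set B" "Suc i \<notin> set A"
    using assms kashiwara_f_iff by blast
  have nth: "x ! k = (if k = length A then i else y ! k)" "y ! length A = Suc i" for k
    using xy by (auto simp: nth_append nth_Cons split: nat.split)
  have "y ! p \<noteq> Suc i" if "p < length A" for p
    using that xy by (metis nth_append_left nth_mem)
  moreover have "y ! q \<noteq> i" if "length A < q" "q < length x" for q
  proof -
    obtain k where "q = Suc (length A + k)"
      using \<open>length A < q\<close> less_iff_Suc_add by auto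
    then have "y ! q = B ! k" "k < length B" using that xy by (auto simp: nth_append)
    then show ?thesis using xy nth_mem by metis
  qed
  ultimately have "x ! p \<le> x ! q \<longleftrightarrow> y ! p \<le> y ! q" if "p < q" "q < length x" for p q
    using that unfolding nth(1) by (auto simp: nth(2) le_Suc_eq Suc_le_eq less_le)
  then show ?thesis using xy by (simp add: same_standardization_def)
qed

text \<open>The comparisons with the last position count the letters at most the last one. This rank
  and the content determine the last letter; then it is removed from both words.\<close>

lemma same_standardization_eqI:
  assumes "same_standardization u v" "mset u = mset v"
  shows "u = v"
  using assms
proof (induction u arbitrary: v rule: rev_induct)
  case (snoc a u)
  then obtain v' b where v: "v = v' @ [b]"
    by (metis append_is_Nil_conv mset.simps(1) mset_zero_iff not_Cons_self2 rev_exhaust)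
  have len: "length u = length v'" using snoc.prems(1) v by (simp add: same_standardization_def)
  have le_iff: "(u @ [a]) ! p \<le> (u @ [a]) ! q \<longleftrightarrow> (v' @ [b]) ! p \<le> (v' @ [b]) ! q"
    if "p < q" "q \<le> length u" for p q
    using snoc.prems(1) that by (simp add: same_standardization_def v)
  have nth: "u ! p \<le> a \<longleftrightarrow> v' ! p \<le> b" if "p < length u" for p
    using le_iff[of p "length u"] that len by (simp add: nth_append)
  have "length (filter (\<lambda>x. x \<le> a) u) = length (filter (\<lambda>x. x \<le> b) v')"
    using nth len by (simp add: length_filter_conv_card cong: conj_cong)
  moreover have size: "length (filter P (u @ [a])) = length (filter P (v' @ [b]))" for P
    using snoc.prems(2) unfolding v by (metis mset_filter size_mset)
  \<comment> \<open>Different last letters would have different ranks in the common content.\<close>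
  have strict: "length (filter (\<lambda>x. x \<le> c) w) < length (filter (\<lambda>x. x \<le> d) w)"
    if "c < d" "d \<in> set w" for c d :: nat and w
    using that
  proof (induction w)
    case (Cons e w)
    have "length (filter (\<lambda>x. x \<le> c) w) \<le> length (filter (\<lambda>x. x \<le> d) w)"
      using \<open>c < d\<close> by (induction w) auto
    then show ?case using Cons by auto
  qed simp
  have mem: "a \<in> set (v' @ [b])" "b \<in> set (u @ [a])"
    using mset_eq_setD[OF snoc.prems(2)] unfolding v by auto
  have "a = b"
  proof (rule ccontr)
    assume "a \<noteq> b"
    then consider "a < b" | "b < a" by linarith
    then show False
    proof cases
      \<comment> \<open>\<open>calculation\<close> still holds the equality of the two counts in
        \<open>u\<close> and \<open>v'\<close>; the last letters add one to each.\<close>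
      case 1
      then show False
        using strict[OF 1 mem(2)] size[of "\<lambda>x. x \<le> b"] calculation by simp
    next
      case 2
      then show False
        using strict[OF 2 mem(1)] size[of "\<lambda>x. x \<le> a"] calculation by simp
    qed
  qed
  moreover have "same_standardization u v'"
    unfolding same_standardization_def
  proof (intro conjI allI impI)
    fix q p assume "q < length u" "p < q"
    then show "u ! p \<le> u ! q \<longleftrightarrow> v' ! p \<le> v' ! q"
      using le_iff[of p q] len by (simp add: nth_append)
  qed (rule len)
  then have "u = v'" using snoc.IH snoc.prems(2) v \<open>a = b\<close> by simp
  ultimately show ?case using v by simp
qed simp


section \<open>Quasi-crystal components\<close>

lemma edge_words: "edge n i x y \<Longrightarrow> x \<in> words n \<and> y \<in> words n"
  by (auto simp: edge_def words_def kashiwara_f_iff)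

lemma component_refl: "u \<in> component n u"
  by (simp add: component_def)

lemma component_closed:
  assumes "edge n i x y"
  shows "x \<in> component n u \<longleftrightarrow> y \<in> component n u"
proof -
  have "equivclp (\<lambda>y z. \<exists>i. edge n i y z) x y" "equivclp (\<lambda>y z. \<exists>i. edge n i y z) y x"
    using assms by (blast intro: r_into_equivclp equivclp_sym)+
  then show ?thesis by (auto simp: component_def elim: equivclp_trans)
qed

lemma component_induct [consumes 1, case_names base forward backward]:
  assumes "x \<in> component n u" and "P u"
    and "\<And>i x y. x \<in> component n u \<Longrightarrow> edge n i x y \<Longrightarrow> P x \<Longrightarrow> P y"
    and "\<And>i x y. y \<in> component n u \<Longrightarrow> edge n i x y \<Longrightarrow> P y \<Longrightarrow> P x"
  shows "P x"
proof -
  have "equivclp (\<lambda>y z. \<exists>i. edge n i y z) u x" using assms(1) by (simp add: component_def)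
  then show ?thesis
    by (induction rule: equivclp_induct) (use assms in \<open>auto simp: component_def\<close>)
qed

lemma component_eqI:
  assumes "x \<in> component n u"
  shows "component n x = component n u"
  using assms unfolding component_def by (auto intro: equivclp_trans equivclp_sym)

lemma wt_eq_iff:
  assumes "u \<in> words n" "v \<in> words n"
  shows "wt n u = wt n v \<longleftrightarrow> mset u = mset v"
proof
  assume "wt n u = wt n v"
  then have *: "count_list u x = count_list v x" if "1 \<le> x" "x \<le> n" for x
    using that unfolding wt_def map_eq_conv by (auto simp del: upt_Suc)
  have "count_list u x = count_list v x" for x
  proof (cases "1 \<le> x \<and> x \<le> n")
    case False
    then have "x \<notin> set u" "x \<notin> set v" using assms by (auto simp: words_def)
    then show ?thesis by simp
  qed (use * in blast)
  then show "mset u = mset v" by (simp add: multiset_eq_iff count_mset)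
next
  assume "mset u = mset v"
  then show "wt n u = wt n v" by (simp add: wt_def multiset_eq_iff count_mset)
qed

lemma same_inversions_sym: "same_inversions u v \<Longrightarrow> same_inversions v u"
  unfolding same_inversions_def by (metis mset_eq_setD)

lemma same_inversions_words: "same_inversions u v \<Longrightarrow> u \<in> words n \<Longrightarrow> v \<in> words n"
  unfolding same_inversions_def words_def by (auto dest: mset_eq_setD)

section \<open>Parallel paths in two components\<close>

text \<open>No letter lies strictly between \<open>i\<close> and \<open>Suc i\<close>, so
  \<open>same_inversions\<close> always compares this pair; together with the support it decides
  whether the operator is defined.\<close>

lemma edge_transfer_forward:
  assumes "same_inversions x y" "edge n i x x'"
  shows "\<exists>y'. edge n i y y'"
proof -
  have "i \<in> set x \<and> \<not> inverted i (Suc i) x"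
    using assms(2) kashiwara_f_defined_iff by (metis edge_def)
  moreover have "inverted i (Suc i) x = inverted i (Suc i) y" "set x = set y"
    using assms(1) unfolding same_inversions_def
    by (metis lessI not_less_eq_eq) (metis assms(1) same_inversions_def mset_eq_setD)
  ultimately obtain y' where "kashiwara_f i y = Some y'"
    using kashiwara_f_defined_iff by metis
  moreover have "y \<in> words n" using assms same_inversions_words edge_words by blast
  ultimately show ?thesis using assms(2) by (auto simp: edge_def)
qed

lemma edge_transfer_backward:
  assumes "same_inversions x' y'" "edge n i x x'"
  shows "\<exists>y. edge n i y y'"
proof -
  have "Suc i \<in> set x' \<and> \<not> inverted i (Suc i) x'"
    using assms(2) kashiwara_f_inverse_defined_iff by (metis edge_def)
  moreover have "inverted i (Suc i) x' = inverted i (Suc i) y'" "set x' = set y'"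
    using assms(1) unfolding same_inversions_def
    by (metis lessI not_less_eq_eq) (metis assms(1) same_inversions_def mset_eq_setD)
  ultimately obtain y where f: "kashiwara_f i y = Some y'"
    using kashiwara_f_inverse_defined_iff by metis
  have "y' \<in> words n" using assms same_inversions_words edge_words by blast
  moreover have i: "1 \<le> i" "i < n" using assms(2) by (auto simp: edge_def)
  ultimately have "y \<in> words n" using kashiwara_f_mset(4)[OF f] by (auto simp: words_def)
  then show ?thesis using i f by (auto simp: edge_def)
qed

text \<open>The graph of the future isomorphism. At first it is only a relation, since different
  paths to \<open>x\<close> might end in different words \<open>y\<close>.\<close>

inductive linked :: "nat \<Rightarrow> nat list \<Rightarrow> nat list \<Rightarrow> nat list \<Rightarrow> nat list \<Rightarrow> bool" for n u v where
  base: "linked n u v u v"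
| forward: "linked n u v x y \<Longrightarrow> edge n i x x' \<Longrightarrow> edge n i y y' \<Longrightarrow> linked n u v x' y'"
| backward: "linked n u v x' y' \<Longrightarrow> edge n i x x' \<Longrightarrow> edge n i y y' \<Longrightarrow> linked n u v x y"

lemma linked_swap: "linked n u v x y \<Longrightarrow> linked n v u y x"
  by (induction rule: linked.induct) (auto intro: linked.intros)

lemma linked_component: "linked n u v x y \<Longrightarrow> x \<in> component n u"
  by (induction rule: linked.induct) (auto simp: component_refl component_closed)

lemma linked_same_standardization: "linked n u v x y \<Longrightarrow> same_standardization u x"
proof (induction rule: linked.induct)
  case (forward x y i x' y')
  then have "same_standardization x x'"
    using kashiwara_f_same_standardization by (auto simp: edge_def)
  then show ?case using forward same_standardization_trans by blast
next
  case (backward x' y' i x y)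
  then have "same_standardization x' x"
    using kashiwara_f_same_standardization same_standardization_sym by (auto simp: edge_def)
  then show ?case using backward same_standardization_trans by blast
qed (rule same_standardization_refl)

lemma linked_same_inversions:
  "linked n u v x y \<Longrightarrow> same_inversions u v \<Longrightarrow> same_inversions x y"
  by (induction rule: linked.induct) (auto simp: edge_def dest: same_inversions_step)

lemma linked_total:
  assumes "x \<in> component n u" "same_inversions u v"
  shows "\<exists>y. linked n u v x y"
  using assms(1)
proof (induction rule: component_induct)
  case (forward i x x')
  then obtain y where "linked n u v x y" by blast
  moreover from this obtain y' where "edge n i y y'"
    using forward(2) edge_transfer_forward linked_same_inversions assms(2) by blast
  ultimately show ?case using forward(2) linked.forward by blast
next
  case (backward i x x')
  then obtain y' where "linked n u v x' y'" by blast
  moreover from this obtain y where "edge n i y y'"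
    using backward(2) edge_transfer_backward linked_same_inversions assms(2) by blast
  ultimately show ?case using backward(2) linked.backward by blast
qed (use linked.base in blast)

text \<open>Both \<open>y\<close> and \<open>y'\<close> have the standardization of \<open>v\<close>
  and the content of \<open>x\<close>.\<close>

lemma linked_functional:
  assumes "linked n u v x y" "linked n u v x y'" "same_inversions u v"
  shows "y = y'"
proof (rule same_standardization_eqI)
  show "same_standardization y y'"
    using assms linked_swap linked_same_standardization same_standardization_sym
      same_standardization_trans by metis
  show "mset y = mset y'"
    using assms linked_same_inversions by (metis same_inversions_def)
qed

lemma linked_edge:
  assumes "linked n u v x y" "linked n u v x' y'" "same_inversions u v" "edge n i x x'"
  shows "edge n i y y'"
proof -
  obtain y'' where y'': "edge n i y y''"
    using assms edge_transfer_forward linked_same_inversions by blast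
  then have "linked n u v x' y''" using assms linked.forward by blast
  then show ?thesis using assms y'' linked_functional by blast
qed

lemma crystal_equiv_if_same_inversions:
  assumes same: "same_inversions u v"
  shows "crystal_equiv n u v"
proof -
  \<comment> \<open>\<open>THE\<close> is justified on the component because the relation is total
    and functional there.\<close>
  define \<theta> where "\<theta> x = (THE y. linked n u v x y)" for x
  note same' = same_inversions_sym[OF same]
  have \<theta>: "\<theta> x = y" if "linked n u v x y" for x y
    unfolding \<theta>_def using that same linked_functional by blast
  have link: "linked n u v x (\<theta> x)" if "x \<in> component n u" for x
    using linked_total[OF that same] \<theta> by metis
  have "bij_betw \<theta> (component n u) (component n v)"
    unfolding bij_betw_def
  proof (intro conjI)
    \<comment> \<open>Injectivity is functionality of the swapped relation.\<close>
    show "inj_on \<theta> (component n u)"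
      using link linked_swap linked_functional same' by (metis inj_onI)
    show "\<theta> ` component n u = component n v"
    proof (intro equalityI subsetI)
      fix y assume "y \<in> component n v"
      then obtain x where "linked n v u y x" using linked_total same' by blast
      then have "linked n u v x y" by (rule linked_swap)
      then show "y \<in> \<theta> ` component n u" using \<theta> linked_component by blast
    qed (use link linked_swap linked_component in blast)
  qed
  moreover have "wt n (\<theta> x) = wt n x" if "x \<in> component n u" for x
  proof -
    have "same_inversions x (\<theta> x)" using linked_same_inversions[OF link[OF that] same] .
    then show ?thesis by (auto simp: wt_def same_inversions_def simp flip: count_mset)
  qed
  moreover have "edge n i x y \<longleftrightarrow> edge n i (\<theta> x) (\<theta> y)"
    if "x \<in> component n u" "y \<in> component n u" for i x y
    using linked_edge[OF link[OF that(1)] link[OF that(2)] same]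
      linked_edge[OF linked_swap[OF link[OF that(1)]] linked_swap[OF link[OF that(2)]] same']
    by blast
  moreover have "\<theta> u = v" using \<theta> linked.base by blast
  ultimately show ?thesis unfolding crystal_equiv_def quasi_crystal_iso_def by blast
qed

section \<open>Recovering inversions from an isomorphism\<close>

text \<open>The same isomorphism serves for the new base points, since an edge does not leave the
  component.\<close>

lemma crystal_equiv_edge_forward:
  assumes "crystal_equiv n u v" "edge n i u u'"
  shows "\<exists>v'. edge n i v v' \<and> crystal_equiv n u' v'"
proof -
  obtain \<theta> where iso: "quasi_crystal_iso n \<theta> (component n u) (component n v)" and v: "\<theta> u = v"
    using assms(1) by (auto simp: crystal_equiv_def)
  have u': "u' \<in> component n u" using assms(2) component_closed component_refl by blast
  have i: "i \<in> {1..<n}" using assms(2) by (auto simp: edge_def)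
  then have "edge n i v (\<theta> u')"
    using iso u' component_refl[of u n] assms(2) v unfolding quasi_crystal_iso_def by blast
  moreover have "\<theta> u' \<in> component n v"
    using iso u' unfolding quasi_crystal_iso_def by (blast dest: bij_betw_apply)
  ultimately show ?thesis
    using iso component_eqI[OF u'] component_eqI unfolding crystal_equiv_def by metis
qed

text \<open>For the converse direction, surjectivity provides a preimage of \<open>v'\<close>, and
  edges are reflected.\<close>

lemma crystal_equiv_edge_iff:
  assumes "crystal_equiv n u v"
  shows "(\<exists>u'. edge n i u u') \<longleftrightarrow> (\<exists>v'. edge n i v v')"
proof
  assume "\<exists>v'. edge n i v v'"
  then obtain v' where v': "edge n i v v'" by blast
  obtain \<theta> where iso: "quasi_crystal_iso n \<theta> (component n u) (component n v)" and v: "\<theta> u = v"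
    using assms by (auto simp: crystal_equiv_def)
  have "v' \<in> component n v" using v' component_closed component_refl by blast
  then obtain u' where "u' \<in> component n u" "\<theta> u' = v'"
    using iso unfolding quasi_crystal_iso_def bij_betw_def by (metis imageE)
  moreover have "i \<in> {1..<n}" using v' by (auto simp: edge_def)
  ultimately show "\<exists>u'. edge n i u u'"
    using iso v v' component_refl[of u n] unfolding quasi_crystal_iso_def by blast
qed (use crystal_equiv_edge_forward assms in blast)

lemma crystal_equiv_mset:
  assumes "crystal_equiv n u v" "u \<in> words n" "v \<in> words n"
  shows "mset u = mset v"
  using assms component_refl wt_eq_iff unfolding crystal_equiv_def quasi_crystal_iso_def by metis

text \<open>
  Raising the rightmost \<open>a\<close> turns a gap between the neighbouring letters \<open>a\<close> and \<open>b\<close> into the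
  smaller gap between \<open>Suc a\<close> and \<open>b\<close> without changing whether they are inverted; for \<open>b = Suc a\<close>
  an inversion is the absence of an outgoing edge.
\<close>

lemma crystal_equiv_inverted:
  assumes "crystal_equiv n u v" "u \<in> words n" "v \<in> words n"
    and "a < b" "a \<in> set u" "b \<in> set u" "\<forall>c\<in>set u. c \<le> a \<or> b \<le> c"
  shows "inverted a b u = inverted a b v"
  using assms
proof (induction "b - a" arbitrary: a u v rule: less_induct)
  case less
  note gap = less.prems(7)
  have sets: "set v = set u"
    using crystal_equiv_mset less.prems(1-3) by (metis mset_eq_setD)
  \<comment> \<open>\<open>a < n\<close> because the larger letter \<open>b\<close> occurs in
    \<open>u\<close>; hence \<open>a\<close> is a legal edge label.\<close>
  have an: "1 \<le> a" "a < n" using less.prems(2,4,5,6) by (auto simp: words_def)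
  have edge_iff: "(\<exists>y. edge n a w y) \<longleftrightarrow> \<not> inverted a (Suc a) w" if "w = u \<or> w = v" for w
    using that less.prems(2,3,5) sets an kashiwara_f_defined_iff[of a w] by (auto simp: edge_def)
  show ?case
  proof (cases "b = Suc a")
    case True
    then show ?thesis using edge_iff crystal_equiv_edge_iff[OF less.prems(1)] by blast
  next
    case False
    then have b: "Suc a < b" using less.prems(4) by simp
    then have no: "Suc a \<notin> set u" using gap by auto
    then have "\<not> inverted a (Suc a) u" using inverted_imp_mem by metis
    then obtain u' where u': "edge n a u u'" using edge_iff by blast
    then obtain v' where v': "edge n a v v'" and eq: "crystal_equiv n u' v'"
      using crystal_equiv_edge_forward less.prems(1) by blast
    have fu: "kashiwara_f a u = Some u'" and fv: "kashiwara_f a v = Some v'"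
      using u' v' by (auto simp: edge_def)
    have "inverted (Suc a) b u' = inverted (Suc a) b v'"
    proof (rule less.hyps)
      show "b - Suc a < b - a" using b by simp
      show "u' \<in> words n" "v' \<in> words n" using u' v' edge_words by blast+
      show "Suc a \<in> set u'" using kashiwara_f_mset(3)[OF fu] .
      show "b \<in> set u'" using kashiwara_f_mset(4)[OF fu] less.prems(4,6) by auto
      show "\<forall>c\<in>set u'. c \<le> Suc a \<or> b \<le> c" using kashiwara_f_mset(5)[OF fu] gap le_SucI by blast
    qed (use eq b in auto)
    then show ?thesis
      using kashiwara_f_inverted(7)[OF fu b no] kashiwara_f_inverted(7)[OF fv b] no sets by simp
  qed
qed

lemma same_inversions_if_crystal_equiv:
  assumes "crystal_equiv n u v" "u \<in> words n" "v \<in> words n"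
  shows "same_inversions u v"
proof -
  have m: "mset u = mset v" by (rule crystal_equiv_mset[OF assms])
  have "inverted a b u = inverted a b v" if "a < b" "\<forall>c\<in>set u. c \<le> a \<or> b \<le> c" for a b
    using crystal_equiv_inverted[OF assms] that inverted_imp_mem mset_eq_setD[OF m] by metis
  then show ?thesis using m by (simp add: same_inversions_def)
qed

theorem theorem6p11:
  fixes n :: nat and u v :: "nat list"
  assumes "u \<in> words n" and "v \<in> words n"
  shows "hypo_cong u v \<longleftrightarrow> crystal_equiv n u v"
  using assms crystal_equiv_if_same_inversions same_inversions_if_crystal_equiv
  unfolding hypo_cong_iff by blast

end
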